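(* Let $b_0,b_1,b_2,\dots$ be i.i.d. random variables with $P(b_n=1)=0.4$ and $P(b_n=0)=0.6$. For each odd positive integer $p$, let $X_0=0$ and $X_{n+1}=2X_n+b_n \pmod p$ for $n\ge 0$, and let $P_n=P_n^{(p)}$ be the distribution of $X_n$ on $\mathbb{Z}/p\mathbb{Z}$, i.e. $P_n(s)=P(X_n=s)$ for $s\in\mathbb{Z}/p\mathbb{Z}$. Let $U$ be the uniform distribution on $\mathbb{Z}/p\mathbb{Z}$. Then there exists a constant $c_2>1$ such that, for every function $p\mapsto n(p)$ from odd positive integers to nonnegative integers with $n(p)<c_2\log_2 p$, one has $\|P_{n(p)}-U\|\to 1$ as $p\to\infty$ through odd integers.
   Context: For a probability $P$ on $\mathbb{Z}/p\mathbb{Z}$, the variation distance from the uniform distribution $U$ is $$\|P-U\|=\frac12\sum_{s\in\mathbb{Z}/p\mathbb{Z}}\left|P(s)-\frac1p\right|=\max_{A\subseteq\mathbb{Z}/p\mathbb{Z}}|P(A)-U(A)|.$$ *)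

theory Defs
  imports "HOL-Probability.Probability"
begin

text \<open>
  The residue ring of integers modulo \<open>p\<close> is represented by the least nonnegative
  residues \<open>{0..<int p}\<close>; a distribution on it is given by its point masses.
\<close>

primrec doubling_walk :: "(nat \<Rightarrow> 'a \<Rightarrow> int) \<Rightarrow> nat \<Rightarrow> nat \<Rightarrow> 'a \<Rightarrow> int" where
  "doubling_walk b p 0 \<omega> = 0"
| "doubling_walk b p (Suc n) \<omega> = (2 * doubling_walk b p n \<omega> + b n \<omega>) mod int p"

definition walk_dist :: "'a measure \<Rightarrow> (nat \<Rightarrow> 'a \<Rightarrow> int) \<Rightarrow> nat \<Rightarrow> nat \<Rightarrow> int \<Rightarrow> real" where
  "walk_dist M b p n s = measure M {\<omega> \<in> space M. doubling_walk b p n \<omega> = s}"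

definition variation_dist_uniform :: "nat \<Rightarrow> (int \<Rightarrow> real) \<Rightarrow> real" where
  "variation_dist_uniform p P = 1 / 2 * (\<Sum>s\<in>{0..<int p}. \<bar>P s - 1 / real p\<bar>)"

end

theory Submission
  imports Defs
begin

text \<open>
  Writing \<open>P\<close> for the distribution after \<open>n\<close> steps, one has
  \<open>1 - \<parallel>P - U\<parallel> = \<Sum>\<^sub>s min (P s) (1/p) \<le> \<Sum>\<^sub>s sqrt (P s / p)\<close>.
  Since \<open>sqrt\<close> is subadditive, each step of the walk multiplies \<open>\<Sum>\<^sub>s sqrt (P s)\<close> by at most
  \<open>\<rho> = sqrt 0.4 + sqrt 0.6\<close>, so that \<open>1 - \<parallel>P - U\<parallel> \<le> \<rho>\<^sup>n / sqrt p\<close>. As the increments are biased,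
  \<open>\<rho> < sqrt 2\<close>, and the bound tends to 0 for \<open>n < c log\<^sub>2 p\<close> as soon as
  \<open>c log\<^sub>2 \<rho> < 1/2\<close>, which allows some \<open>c > 1\<close>.
\<close>

section \<open>Square roots and variation distance\<close>

lemma sqrt_sum_le_sum_sqrt:
  assumes "\<And>x. x \<in> A \<Longrightarrow> 0 \<le> f x"
  shows "sqrt (sum f A) \<le> (\<Sum>x\<in>A. sqrt (f x))"
  using assms
proof (induction A rule: infinite_finite_induct)
  case (insert x A)
  have "sqrt (f x + sum f A) \<le> sqrt (f x) + sqrt (sum f A)"
    using insert.prems by (intro sqrt_add_le_add_sqrt sum_nonneg) auto
  also have "sqrt (sum f A) \<le> (\<Sum>x\<in>A. sqrt (f x))"
    using insert by auto
  finally show ?case using insert.hyps by simp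
qed auto

text \<open>Pointwise |x - y| = x + y - 2 min x y, and both \<open>P\<close> and the uniform
  distribution have total mass 1.\<close>

lemma variation_dist_uniform_eq:
  assumes "0 < p" and "(\<Sum>s\<in>{0..<int p}. P s) = 1"
  shows "variation_dist_uniform p P = 1 - (\<Sum>s\<in>{0..<int p}. min (P s) (1 / real p))"
proof -
  have "(\<Sum>s\<in>{0..<int p}. \<bar>P s - 1 / real p\<bar>)
      = (\<Sum>s\<in>{0..<int p}. P s + 1 / real p - 2 * min (P s) (1 / real p))"
    by (intro sum.cong) auto
  also have "\<dots> = 2 - 2 * (\<Sum>s\<in>{0..<int p}. min (P s) (1 / real p))"
    using assms by (simp add: sum.distrib sum_subtractf flip: sum_distrib_left)
  finally show ?thesis by (simp add: variation_dist_uniform_def)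
qed

lemma min_le_sqrt_mult:
  fixes x y :: real
  assumes "0 \<le> x" "0 \<le> y"
  shows "min x y \<le> sqrt (x * y)"
proof (rule real_le_rsqrt)
  show "(min x y)\<^sup>2 \<le> x * y"
    unfolding power2_eq_square using assms by (intro mult_mono) auto
qed

section \<open>The walk as a function of its increments\<close>

lemma doubling_walk_range: "0 < p \<Longrightarrow> doubling_walk b p n \<omega> \<in> {0..<int p}"
  by (cases n) auto

text \<open>The position at time \<open>n\<close> depends only on the first \<open>n\<close>
  increments. The sample spaces of \<open>b\<close> and \<open>b'\<close> may differ, so the walk
  can be transferred to coordinate functions on a product space.\<close>

lemma doubling_walk_cong:
  "(\<And>i. i < n \<Longrightarrow> b i \<omega> = b' i \<omega>') \<Longrightarrow> doubling_walk b p n \<omega> = doubling_walk b' p n \<omega>'"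
  by (induction n) auto

text \<open>Only indices below \<open>n\<close> are assumed measurable because the lemma is also
  applied to the coordinates of a product over \<open>{..<n}\<close>.\<close>

lemma measurable_doubling_walk:
  assumes "\<And>i. i < n \<Longrightarrow> b i \<in> M \<rightarrow>\<^sub>M count_space UNIV"
  shows "doubling_walk b p n \<in> M \<rightarrow>\<^sub>M count_space UNIV"
  using assms
proof (induction n)
  case 0
  have "doubling_walk b p 0 = (\<lambda>_. 0)" by auto
  then show ?case by simp
next
  case (Suc n)
  have [measurable]: "doubling_walk b p n \<in> M \<rightarrow>\<^sub>M count_space UNIV"
    "b n \<in> M \<rightarrow>\<^sub>M count_space UNIV" using Suc by auto
  have "doubling_walk b p (Suc n) = (\<lambda>\<omega>. (2 * doubling_walk b p n \<omega> + b n \<omega>) mod int p)" by auto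
  then show ?case by simp
qed

section \<open>Distribution of the walk and growth of its square-root sum\<close>

context prob_space
begin

text \<open>The walk at time \<open>n\<close> is a function of the increments with index below
  \<open>n\<close>, and these are jointly independent of \<open>b n\<close>.\<close>

lemma indep_var_doubling_walk:
  assumes "indep_vars (\<lambda>_. count_space UNIV) b UNIV"
  shows "indep_var (count_space UNIV) (doubling_walk b p n) (count_space UNIV) (b n)"
proof -
  let ?N = "\<lambda>A. PiM A (\<lambda>_. count_space UNIV) :: (nat \<Rightarrow> int) measure"
  \<comment> \<open>Grouping over the disjoint index sets \<open>{..<n}\<close> and
    \<open>{n}\<close> yields two independent random functions; composing with the walk on
    coordinates and with the projection to \<open>n\<close> recovers the two variables.\<close>
  have "indep_var (?N {..<n}) (\<lambda>\<omega>. \<lambda>i\<in>{..<n}. b i \<omega>) (?N {n}) (\<lambda>\<omega>. \<lambda>i\<in>{n}. b i \<omega>)"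
    using assms by (intro indep_var_restrict[where I = UNIV]) auto
  moreover have "doubling_walk (\<lambda>i f. f i) p n \<in> ?N {..<n} \<rightarrow>\<^sub>M count_space UNIV"
    by (intro measurable_doubling_walk measurable_component_singleton) auto
  moreover have "(\<lambda>f. f n) \<in> ?N {n} \<rightarrow>\<^sub>M count_space UNIV"
    by (intro measurable_component_singleton) auto
  ultimately have "indep_var (count_space UNIV)
      (doubling_walk (\<lambda>i f. f i) p n \<circ> (\<lambda>\<omega>. \<lambda>i\<in>{..<n}. b i \<omega>))
      (count_space UNIV) ((\<lambda>f. f n) \<circ> (\<lambda>\<omega>. \<lambda>i\<in>{n}. b i \<omega>))"
    by (rule indep_var_compose)
  moreover have "doubling_walk (\<lambda>i f. f i) p n \<circ> (\<lambda>\<omega>. \<lambda>i\<in>{..<n}. b i \<omega>) = doubling_walk b p n"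
    by (intro ext) (auto intro!: doubling_walk_cong)
  moreover have "(\<lambda>f. f n) \<circ> (\<lambda>\<omega>. \<lambda>i\<in>{n}. b i \<omega>) = b n"
    by auto
  ultimately show ?thesis by simp
qed

lemma sum_walk_dist:
  assumes "0 < p" and "\<And>i. random_variable (count_space UNIV) (b i)"
  shows "(\<Sum>s\<in>{0..<int p}. walk_dist M b p n s) = 1"
proof -
  have [measurable]: "random_variable (count_space UNIV) (doubling_walk b p n)"
    using assms(2) by (rule measurable_doubling_walk)
  let ?E = "\<lambda>s. {\<omega> \<in> space M. doubling_walk b p n \<omega> = s}"
  have "(\<Sum>s\<in>{0..<int p}. walk_dist M b p n s) = prob (\<Union>s\<in>{0..<int p}. ?E s)"
    unfolding walk_dist_def
    by (rule finite_measure_finite_Union[symmetric]) (auto simp: disjoint_family_on_def)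
  also have "(\<Union>s\<in>{0..<int p}. ?E s) = space M"
    using doubling_walk_range[OF assms(1), of b n] by auto
  finally show ?thesis by (simp add: prob_space)
qed

text \<open>Split by the position \<open>t\<close> and the increment \<open>c\<close> that lead to
  \<open>s\<close>. Up to a null set, finitely many such pairs cover the event, and independence
  turns each joint probability into a product.\<close>

lemma walk_dist_Suc_le:
  assumes "0 < p" and indep: "indep_vars (\<lambda>_. count_space UNIV) b UNIV"
    and "finite C" and "AE \<omega> in M. b n \<omega> \<in> C"
  shows "walk_dist M b p (Suc n) s \<le>
    (\<Sum>(t, c)\<in>{(t, c) \<in> {0..<int p} \<times> C. (2 * t + c) mod int p = s}.
      walk_dist M b p n t * prob {\<omega> \<in> space M. b n \<omega> = c})"
    (is "_ \<le> sum _ ?T")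
proof -
  have rv: "random_variable (count_space UNIV) (b i)" for i
    using indep by (auto simp: indep_vars_def)
  note [measurable] = rv measurable_doubling_walk[of n b M p, OF rv]
    measurable_doubling_walk[of "Suc n" b M p, OF rv]
  let ?E = "\<lambda>x. {\<omega> \<in> space M. doubling_walk b p n \<omega> = fst x \<and> b n \<omega> = snd x}"
  have fin: "finite ?T"
    by (rule finite_subset[of _ "{0..<int p} \<times> C"]) (use assms(3) in auto)
  have "walk_dist M b p (Suc n) s \<le> prob (\<Union>x\<in>?T. ?E x)"
    unfolding walk_dist_def
  proof (rule finite_measure_mono_AE)
    show "AE \<omega> in M. \<omega> \<in> {\<omega> \<in> space M. doubling_walk b p (Suc n) \<omega> = s} \<longrightarrow>
      \<omega> \<in> (\<Union>x\<in>?T. ?E x)"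
      using assms(4) by eventually_elim (use doubling_walk_range[OF assms(1), of b n] in auto)
    show "(\<Union>x\<in>?T. ?E x) \<in> events"
      using fin by (intro sets.finite_UN) measurable
  qed
  also have "\<dots> \<le> (\<Sum>x\<in>?T. prob (?E x))"
    using fin by (intro measure_UNION_le) measurable
  also have "\<dots> = (\<Sum>(t, c)\<in>?T. walk_dist M b p n t * prob {\<omega> \<in> space M. b n \<omega> = c})"
  proof (intro sum.cong refl, clarify)
    fix t c
    have "prob (?E (t, c)) = prob ((\<lambda>\<omega>. (doubling_walk b p n \<omega>, b n \<omega>)) -` ({t} \<times> {c}) \<inter> space M)"
      by (rule arg_cong[where f = prob]) auto
    also have "\<dots> = prob (doubling_walk b p n -` {t} \<inter> space M) * prob (b n -` {c} \<inter> space M)"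
      by (rule indep_varD[OF indep_var_doubling_walk[OF indep]]) auto
    also have "\<dots> = walk_dist M b p n t * prob {\<omega> \<in> space M. b n \<omega> = c}"
      unfolding walk_dist_def by (simp add: vimage_def Int_def conj_commute)
    finally show "prob (?E (t, c)) = walk_dist M b p n t * prob {\<omega> \<in> space M. b n \<omega> = c}" .
  qed
  finally show ?thesis .
qed

text \<open>Subadditivity of the square root separates the pairs leading to each \<open>s\<close>.
  The fibres of \<open>?g\<close> partition all pairs, so the resulting sum runs over a full product
  and factors.\<close>

lemma sum_sqrt_walk_dist_Suc_le:
  assumes "0 < p" and "indep_vars (\<lambda>_. count_space UNIV) b UNIV"
    and "finite C" and "AE \<omega> in M. b n \<omega> \<in> C"
  shows "(\<Sum>s\<in>{0..<int p}. sqrt (walk_dist M b p (Suc n) s)) \<le>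
    (\<Sum>s\<in>{0..<int p}. sqrt (walk_dist M b p n s)) *
    (\<Sum>c\<in>C. sqrt (prob {\<omega> \<in> space M. b n \<omega> = c}))"
proof -
  let ?q = "\<lambda>c. prob {\<omega> \<in> space M. b n \<omega> = c}" and ?P = "walk_dist M b p n"
  let ?g = "\<lambda>(t, c). (2 * t + c) mod int p"
  have "(\<Sum>s\<in>{0..<int p}. sqrt (walk_dist M b p (Suc n) s)) \<le>
    (\<Sum>s\<in>{0..<int p}. \<Sum>x\<in>{x \<in> {0..<int p} \<times> C. ?g x = s}. sqrt (?P (fst x)) * sqrt (?q (snd x)))"
  proof (rule sum_mono)
    fix s
    have "sqrt (walk_dist M b p (Suc n) s) \<le>
        sqrt (\<Sum>x\<in>{x \<in> {0..<int p} \<times> C. ?g x = s}. ?P (fst x) * ?q (snd x))"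
      using walk_dist_Suc_le[OF assms, of s] by (simp add: case_prod_unfold mem_Times_iff)
    also have "\<dots> \<le> (\<Sum>x\<in>{x \<in> {0..<int p} \<times> C. ?g x = s}. sqrt (?P (fst x) * ?q (snd x)))"
      by (rule sqrt_sum_le_sum_sqrt) (simp add: walk_dist_def)
    finally show "sqrt (walk_dist M b p (Suc n) s) \<le>
        (\<Sum>x\<in>{x \<in> {0..<int p} \<times> C. ?g x = s}. sqrt (?P (fst x)) * sqrt (?q (snd x)))"
      by (simp add: real_sqrt_mult)
  qed
  also have "\<dots> = (\<Sum>x\<in>{0..<int p} \<times> C. sqrt (?P (fst x)) * sqrt (?q (snd x)))"
    by (rule sum.group) (use assms in auto)
  also have "\<dots> = (\<Sum>s\<in>{0..<int p}. sqrt (?P s)) * (\<Sum>c\<in>C. sqrt (?q c))"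
    by (simp add: sum_product sum.cartesian_product case_prod_unfold)
  finally show ?thesis .
qed

text \<open>The walk starts from a point mass, whose square-root sum is 1, and each step costs at
  most a factor \<open>\<rho>\<close>.\<close>

lemma sum_sqrt_walk_dist_le:
  assumes "0 < p" and "indep_vars (\<lambda>_. count_space UNIV) b UNIV"
    and "finite C" and "\<And>i. AE \<omega> in M. b i \<omega> \<in> C"
    and \<rho>: "\<And>i. (\<Sum>c\<in>C. sqrt (prob {\<omega> \<in> space M. b i \<omega> = c})) \<le> \<rho>"
  shows "(\<Sum>s\<in>{0..<int p}. sqrt (walk_dist M b p n s)) \<le> \<rho> ^ n"
proof (induction n)
  case 0
  have "walk_dist M b p 0 s = of_bool (s = 0)" for s
    by (auto simp: walk_dist_def prob_space)
  then have "(\<Sum>s\<in>{0..<int p}. sqrt (walk_dist M b p 0 s)) = (\<Sum>s\<in>{0..<int p}. of_bool (s = 0))"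
    by (intro sum.cong) auto
  also have "\<dots> = 1"
    using assms(1) by (simp add: of_bool_def)
  finally show ?case by simp
next
  case (Suc n)
  have "(\<Sum>s\<in>{0..<int p}. sqrt (walk_dist M b p (Suc n) s)) \<le>
    (\<Sum>s\<in>{0..<int p}. sqrt (walk_dist M b p n s)) *
    (\<Sum>c\<in>C. sqrt (prob {\<omega> \<in> space M. b n \<omega> = c}))"
    using assms by (intro sum_sqrt_walk_dist_Suc_le) auto
  also have "\<dots> \<le> \<rho> ^ n * \<rho>"
    \<comment> \<open>Monotonicity of the product needs 0 \<le> \<open>\<rho> ^ n\<close>; this
      follows from the induction hypothesis, whose left-hand side is a sum of nonnegative
      terms.\<close>
    using Suc \<rho> by (intro mult_mono) (auto intro!: sum_nonneg order_trans[OF _ Suc] simp: walk_dist_def)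
  finally show ?case by (simp add: mult.commute)
qed

text \<open>The overlap \<open>min (P s) (1/p)\<close> is at most the geometric mean of its
  arguments, so the total overlap is at most the square-root sum divided by \<open>sqrt p\<close>;
  it is also nonnegative.\<close>

lemma variation_dist_walk_dist_bounds:
  assumes "0 < p" and indep: "indep_vars (\<lambda>_. count_space UNIV) b UNIV"
    and "finite C" and "\<And>i. AE \<omega> in M. b i \<omega> \<in> C"
    and "\<And>i. (\<Sum>c\<in>C. sqrt (prob {\<omega> \<in> space M. b i \<omega> = c})) \<le> \<rho>"
  shows "1 - \<rho> ^ n / sqrt (real p) \<le> variation_dist_uniform p (walk_dist M b p n)"
    and "variation_dist_uniform p (walk_dist M b p n) \<le> 1"
proof -
  let ?P = "walk_dist M b p n"
  have nonneg: "0 \<le> ?P s" for s by (simp add: walk_dist_def)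
  have "(\<Sum>s\<in>{0..<int p}. ?P s) = 1"
    using assms(1) indep by (intro sum_walk_dist) (auto simp: indep_vars_def)
  note vd = variation_dist_uniform_eq[OF assms(1) this]
  have "(\<Sum>s\<in>{0..<int p}. min (?P s) (1 / real p)) \<le> (\<Sum>s\<in>{0..<int p}. sqrt (?P s * (1 / real p)))"
    using nonneg by (intro sum_mono min_le_sqrt_mult) auto
  also have "\<dots> = (\<Sum>s\<in>{0..<int p}. sqrt (?P s)) / sqrt (real p)"
    by (simp add: real_sqrt_divide sum_divide_distrib)
  also have "\<dots> \<le> \<rho> ^ n / sqrt (real p)"
    using sum_sqrt_walk_dist_le[OF assms] by (intro divide_right_mono) auto
  finally show "1 - \<rho> ^ n / sqrt (real p) \<le> variation_dist_uniform p ?P"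
    unfolding vd by simp
  show "variation_dist_uniform p ?P \<le> 1"
    unfolding vd using nonneg by (simp add: sum_nonneg)
qed

end

theorem theorem2:
  fixes M :: "'a measure" and b :: "nat \<Rightarrow> 'a \<Rightarrow> int"
  assumes "prob_space M"
    and "prob_space.indep_vars M (\<lambda>_. count_space UNIV) b UNIV"
    and "\<And>n. measure M {\<omega> \<in> space M. b n \<omega> = 1} = 0.4"
    and "\<And>n. measure M {\<omega> \<in> space M. b n \<omega> = 0} = 0.6"
  shows "\<exists>c\<^sub>2::real. c\<^sub>2 > 1 \<and>
    (\<forall>n :: nat \<Rightarrow> nat.
      (\<forall>p. odd p \<and> p > 1 \<longrightarrow> real (n p) < c\<^sub>2 * log 2 (real p)) \<longrightarrow>
      ((\<lambda>p. variation_dist_uniform p (walk_dist M b p (n p))) \<longlongrightarrow> 1)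
        (inf at_top (principal {p. odd p})))"
proof -

  \<comment> \<open>Choice of the constant\<close>
  interpret prob_space M by fact
  define \<rho> where "\<rho> = sqrt 0.4 + sqrt (0.6 :: real)"
  have \<rho>2: "\<rho>\<^sup>2 = 1 + 2 * sqrt 0.24"
    by (simp add: \<rho>_def power2_sum flip: real_sqrt_mult)
  \<comment> \<open>The bias enters here: 0.4 * 0.6 < 1/4, whereas a fair coin would give equality
    and \<rho> squared equal to 2.\<close>
  have "sqrt (0.24 :: real) < 0.5"
    by (rule real_less_lsqrt) (auto simp: power2_eq_square)
  then have \<rho>2_less: "\<rho>\<^sup>2 < 2" using \<rho>2 by simp
  have "0 < \<rho>" by (simp add: \<rho>_def add_pos_pos)
  have "1 \<le> \<rho>"
    by (rule power2_le_imp_le) (use \<rho>2 \<open>0 < \<rho>\<close> in auto)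
  define r where "r = log 2 \<rho>"
  have "0 \<le> r" using \<open>1 \<le> \<rho>\<close> by (simp add: r_def)
  have "2 * r = log 2 (\<rho>\<^sup>2)" using \<open>0 < \<rho>\<close> by (simp add: r_def log_nat_power)
  also have "\<dots> < 1" using \<rho>2_less \<open>0 < \<rho>\<close> by simp
  finally have "2 * r < 1" .
  \<comment> \<open>Both 1 < \<open>c\<close> and \<open>c * r\<close> < 1/2 are equivalent to 2
    \<open>r\<close> < 1 for this choice.\<close>
  define c where "c = 2 / (1 + 2 * r)"
  have "1 < c" and cr: "c * r < 1 / 2"
    using \<open>0 \<le> r\<close> \<open>2 * r < 1\<close> by (auto simp: c_def field_simps)

  \<comment> \<open>The two given point masses already add up to 1.\<close>
  have AE: "AE \<omega> in M. b i \<omega> \<in> {0, 1}" for i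
  proof -
    have [measurable]: "random_variable (count_space UNIV) (b i)"
      using assms(2) by (auto simp: indep_vars_def)
    have "prob {\<omega> \<in> space M. b i \<omega> \<in> {0, 1}}
        = prob ({\<omega> \<in> space M. b i \<omega> = 0} \<union> {\<omega> \<in> space M. b i \<omega> = 1})"
      by (rule arg_cong[where f = prob]) auto
    also have "\<dots> = 1"
      by (subst finite_measure_Union) (auto simp: assms(3,4))
    finally show ?thesis by (subst (asm) prob_Collect_eq_1) auto
  qed
  have sum_le: "(\<Sum>c\<in>{0, 1}. sqrt (prob {\<omega> \<in> space M. b i \<omega> = c})) \<le> \<rho>" for i
    by (simp add: assms(3,4) \<rho>_def)
  note bounds = variation_dist_walk_dist_bounds[OF _ assms(2) _ AE sum_le]

  \<comment> \<open>Passage to the limit along odd moduli\<close>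
  show ?thesis
  proof (intro exI conjI allI impI)
    show "1 < c" by fact
    fix n :: "nat \<Rightarrow> nat"
    assume n: "\<forall>p. odd p \<and> p > 1 \<longrightarrow> real (n p) < c * log 2 (real p)"
    let ?F = "inf at_top (principal {p. odd p}) :: nat filter"
    have ev: "\<forall>\<^sub>F p in ?F. odd p \<and> 1 < p"
      unfolding eventually_inf_principal
      using eventually_gt_at_top[of 1] by eventually_elim auto
    have lower: "1 - real p powr (c * r - 1 / 2) \<le> variation_dist_uniform p (walk_dist M b p (n p))"
      if p: "odd p \<and> 1 < p" for p
    proof -
      have "\<rho> ^ n p = \<rho> powr real (n p)"
        using \<open>0 < \<rho>\<close> by (simp add: powr_realpow)
      \<comment> \<open>Since 1 \<le> \<rho>, the power grows with the exponent, so the bound on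
        \<open>n p\<close> can be inserted.\<close>
      also have "\<dots> \<le> \<rho> powr (c * log 2 (real p))"
        using \<open>1 \<le> \<rho>\<close> n p by (intro powr_mono) (auto intro: less_imp_le)
      \<comment> \<open>Base and argument are exchanged: \<rho> to the power log 2 p equals p to the
        power log 2 \<rho>, which is \<open>r\<close>.\<close>
      also have "\<dots> = real p powr (c * r)"
        using \<open>0 < \<rho>\<close> p by (simp add: r_def powr_def log_def)
      finally have "\<rho> ^ n p / sqrt (real p) \<le> real p powr (c * r) / real p powr (1 / 2)"
        by (simp add: powr_half_sqrt divide_right_mono)
      then show ?thesis
        using bounds(1)[of p "n p"] p by (simp add: powr_diff)
    qed
    show "((\<lambda>p. variation_dist_uniform p (walk_dist M b p (n p))) \<longlongrightarrow> 1) ?F"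
    proof (rule tendsto_sandwich)
      \<comment> \<open>The exponent is negative by the choice of \<open>c\<close>. The limit over
        all \<open>p\<close> is then restricted to the coarser demand of odd
        \<open>p\<close>.\<close>
      have "((\<lambda>p::nat. real p powr (c * r - 1 / 2)) \<longlongrightarrow> 0) at_top"
        using cr by (intro tendsto_neg_powr filterlim_real_sequentially) auto
      then have "((\<lambda>p::nat. 1 - real p powr (c * r - 1 / 2)) \<longlongrightarrow> 1 - 0) at_top"
        by (intro tendsto_intros)
      then show "((\<lambda>p. 1 - real p powr (c * r - 1 / 2)) \<longlongrightarrow> 1) ?F"
        by (auto intro: tendsto_mono[OF inf_le1])
      show "\<forall>\<^sub>F p in ?F. 1 - real p powr (c * r - 1 / 2)
          \<le> variation_dist_uniform p (walk_dist M b p (n p))"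
        using ev by eventually_elim (rule lower)
      show "\<forall>\<^sub>F p in ?F. variation_dist_uniform p (walk_dist M b p (n p)) \<le> 1"
        using ev by eventually_elim (rule bounds(2), auto)
    qed (rule tendsto_const)
  qed
qed

end
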